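(* If $\vec{P}$ is an oriented path in which every block of $\vec{P}$ has length at least two and every internal block of $\vec P$ has length divisible by four, then $\vec{P}$ is tournament anti-Sidorenko.
   Context: An oriented graph $\vec{H}$ is a pair $(V(\vec{H}),A(\vec{H}))$ with (finite) vertex set $V(\vec H)$ and arc set $A(\vec{H})\subseteq V(\vec{H})\times V(\vec{H})$ containing no self-loops and at most one arc between any pair of distinct vertices. Write $v(\vec H)=|V(\vec H)|$ and $a(\vec H)=|A(\vec H)|$. A tournament is an oriented graph with exactly one arc between every pair of distinct vertices. A homomorphism $f:\vec H\to\vec G$ is a function $f:V(\vec H)\to V(\vec G)$ such that $(f(u),f(v))\in A(\vec G)$ for all $(u,v)\in A(\vec H)$; $\hom(\vec H,\vec G)$ is the number of homomorphisms and $t(\vec H,\vec G)=\hom(\vec H,\vec G)/v(\vec G)^{v(\vec H)}$. An oriented graph $\vec H$ is tournament anti-Sidorenko if $t(\vec H,\vec T)\le (1/2)^{a(\vec H)}$ for every tournament $\vec T$. An oriented path is an oriented graph obtained by choosing a direction for each edge of an undirected path. A block of an oriented path $\vec P$ is a maximal subpath in which all arcs are oriented in the same direction (along the path); its length is its number of arcs. A block is internal if it does not contain a leaf (end vertex) of $\vec P$. *)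

theory Defs
  imports Complex_Main "Graph_Theory.Pair_Digraph" "Graph_Theory.Digraph_Component"
begin

locale oriented_graph = pair_digraph +
  assumes arc_antisym: "(u, v) \<in> parcs G \<Longrightarrow> (v, u) \<notin> parcs G"

locale tournament = oriented_graph +
  assumes arc_total:
    "\<lbrakk>u \<in> pverts G; v \<in> pverts G; u \<noteq> v\<rbrakk> \<Longrightarrow> (u, v) \<in> parcs G \<or> (v, u) \<in> parcs G"

text \<open>The functions are restricted to be \<^term>\<open>undefined\<close> outside the vertex set of \<open>H\<close>, so that
  each homomorphism is counted exactly once.\<close>

definition homs :: "'a pair_pre_digraph \<Rightarrow> 'b pair_pre_digraph \<Rightarrow> ('a \<Rightarrow> 'b) set" where
  "homs H G = {f \<in> pverts H \<rightarrow>\<^sub>E pverts G. \<forall>(u, v) \<in> parcs H. (f u, f v) \<in> parcs G}"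

definition hom_count :: "'a pair_pre_digraph \<Rightarrow> 'b pair_pre_digraph \<Rightarrow> nat" where
  "hom_count H G = card (homs H G)"

definition hom_density :: "'a pair_pre_digraph \<Rightarrow> 'b pair_pre_digraph \<Rightarrow> real" where
  "hom_density H G = real (hom_count H G) / real (card (pverts G)) ^ card (pverts H)"

text \<open>The type argument is the vertex type of the tournaments quantified over; the notion over all
  tournaments is obtained by leaving this type arbitrary.\<close>

definition tournament_anti_sidorenko :: "'b itself \<Rightarrow> 'a pair_pre_digraph \<Rightarrow> bool" where
  "tournament_anti_sidorenko (_ :: 'b itself) H \<longleftrightarrow>
     (\<forall>T :: 'b pair_pre_digraph. tournament T \<longrightarrow> hom_density H T \<le> (1/2) ^ card (parcs H))"

text \<open>\<open>path_order P vs\<close>: the underlying undirected graph of \<open>P\<close> is the path whose vertices are, in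
  this order, those of \<open>vs\<close>.\<close>

definition path_order :: "'a pair_pre_digraph \<Rightarrow> 'a list \<Rightarrow> bool" where
  "path_order P vs \<longleftrightarrow> vs \<noteq> [] \<and> distinct vs \<and> set vs = pverts P \<and>
     {{u, v} | u v. (u, v) \<in> parcs P} = {{vs ! i, vs ! Suc i} | i. Suc i < length vs}"

definition oriented_path :: "'a pair_pre_digraph \<Rightarrow> bool" where
  "oriented_path P \<longleftrightarrow> oriented_graph P \<and> (\<exists>vs. path_order P vs)"

text \<open>A subpath all of whose arcs point in the same direction. It may be listed from either end, so
  the direction can be taken to be that of the listing.\<close>

definition directed_subpath :: "'a pair_pre_digraph \<Rightarrow> 'a pair_pre_digraph \<Rightarrow> bool" where
  "directed_subpath P B \<longleftrightarrow> subgraph (with_proj B) (with_proj P) \<and> oriented_graph B \<and>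
     (\<exists>vs. path_order B vs \<and> (\<forall>i. Suc i < length vs \<longrightarrow> (vs ! i, vs ! Suc i) \<in> parcs B))"

text \<open>The requirement of at least one arc matters only for the path with a single vertex, which
  thereby has no blocks; in any other path a single vertex is never maximal.\<close>

definition block :: "'a pair_pre_digraph \<Rightarrow> 'a pair_pre_digraph \<Rightarrow> bool" where
  "block P B \<longleftrightarrow> parcs B \<noteq> {} \<and> directed_subpath P B \<and>
     (\<forall>B'. directed_subpath P B' \<and> subgraph (with_proj B) (with_proj B') \<longrightarrow> B' = B)"

definition leaf :: "'a pair_pre_digraph \<Rightarrow> 'a \<Rightarrow> bool" where
  "leaf P v \<longleftrightarrow> v \<in> pverts P \<and> in_degree (with_proj P) v + out_degree (with_proj P) v = 1"

definition internal_block :: "'a pair_pre_digraph \<Rightarrow> 'a pair_pre_digraph \<Rightarrow> bool" where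
  "internal_block P B \<longleftrightarrow> block P B \<and> (\<forall>v \<in> pverts B. \<not> leaf P v)"

end

theory Submission
  imports Defs "HOL-Library.Function_Algebras"
begin

text \<open>
  Why the theorem holds. Let the tournament have vertex set \<open>V\<close> with \<open>n\<close> elements, and let
  \<open>s v u\<close> be \<open>1\<close>, \<open>-1\<close> or \<open>0\<close> according to the arc between \<open>v\<close> and \<open>u\<close>. Up to entries on the
  diagonal, which only make it larger, twice the adjacency matrix divided by \<open>n\<close> is the operator
  \<open>U = J + S\<close> on functions \<open>V \<Rightarrow> \<real>\<close>, where \<open>J\<close> is the orthogonal projection onto the constant
  function \<open>e = 1\<close> and \<open>S\<close>, the operator with kernel \<open>s\<close>, is skew-symmetric; traversing an arc backwards
  corresponds to the transpose \<open>J - S\<close>. A homomorphic image of a path with \<open>k\<close> arcs is a walk with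
  prescribed directions, so the theorem says that \<open>e \<cdot> W e \<le> 1\<close>, where \<open>W\<close> is the product of \<open>k\<close>
  factors \<open>J \<plusminus> S\<close>, one for every arc.

  The entries of \<open>s\<close> bound the Hilbert-Schmidt norm of \<open>S\<close> by \<open>1\<close>, and the singular values of a
  skew-symmetric operator come in equal pairs; hence \<open>\<bar>S x\<bar>\<^sup>2 \<le> \<bar>x\<bar>\<^sup>2 / 2\<close>
  (\<open>kernel_op_contraction\<close>). This is all that is used about \<open>S\<close>. It implies

  \<^item> \<open>\<bar>U\<^sup>4 x\<bar> \<le> \<bar>x\<bar>\<close> for all \<open>x\<close> (\<open>nrm_U_pow_4\<close>), although \<open>U\<close> and \<open>U\<^sup>2\<close> can have norm greater
    than \<open>1\<close>;
  \<^item> \<open>\<bar>U\<^sup>a e\<bar> \<le> 1\<close> for all \<open>a \<noteq> 1\<close> (\<open>nrm_U_pow_unit\<close>), although \<open>\<bar>U e\<bar> > 1\<close> whenever \<open>S e \<noteq> 0\<close>,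

  and the same for the transpose, which is \<open>U\<close> for \<open>-S\<close>. Now group the factors of \<open>W\<close> by blocks. The
  first block, moved to the left argument of the inner product, and the last one act on \<open>e\<close> and
  produce vectors of norm at most \<open>1\<close> because their lengths are at least two; the internal blocks are
  contractions because their lengths are multiples of four. The Cauchy-Schwarz inequality finishes the
  proof (\<open>walk_form_le_1\<close>).

  What remains is to identify the blocks of the path with the maximal constant runs in its sequence
  of directions (\<open>block_of_run\<close>).
\<close>

section \<open>Semi-inner products\<close>

text \<open>
  The carrier of the inner product will be the functions on an arbitrary vertex type, averaged over
  the finite vertex set of a tournament. Functions that vanish on this set have norm zero, which is why
  the form is only assumed to be semidefinite.
\<close>

locale semi_inner_product =
  fixes ip :: "'v::real_vector \<Rightarrow> 'v \<Rightarrow> real" (infixl "\<cdot>" 70)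
  assumes ip_commute: "x \<cdot> y = y \<cdot> x"
    and ip_add_left: "(x + y) \<cdot> z = x \<cdot> z + y \<cdot> z"
    and ip_scaleR_left: "(a *\<^sub>R x) \<cdot> z = a * (x \<cdot> z)"
    and ip_nonneg: "0 \<le> x \<cdot> x"
begin

lemma ip_add_right: "z \<cdot> (x + y) = z \<cdot> x + z \<cdot> y"
  using ip_add_left ip_commute by simp

lemma ip_scaleR_right: "z \<cdot> (a *\<^sub>R x) = a * (z \<cdot> x)"
  using ip_scaleR_left ip_commute by simp

lemma ip_minus_left: "(- x) \<cdot> z = - (x \<cdot> z)"
  using ip_scaleR_left[of "-1" x z] by simp

lemma ip_minus_right: "z \<cdot> (- x) = - (z \<cdot> x)"
  using ip_scaleR_right[of z "-1" x] by simp

lemma ip_diff_left: "(x - y) \<cdot> z = x \<cdot> z - y \<cdot> z"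
  using ip_add_left[of x "- y" z] by (simp add: ip_minus_left)

lemma ip_diff_right: "z \<cdot> (x - y) = z \<cdot> x - z \<cdot> y"
  using ip_add_right[of z x "- y"] by (simp add: ip_minus_right)

lemmas ip_linear = ip_add_left ip_add_right ip_scaleR_left ip_scaleR_right
  ip_minus_left ip_minus_right ip_diff_left ip_diff_right

lemma Cauchy_Schwarz_square: "(x \<cdot> y)\<^sup>2 \<le> (x \<cdot> x) * (y \<cdot> y)"
proof (cases "y \<cdot> y = 0")
  case True
  \<comment> \<open>The form may be degenerate, so \<open>y\<close> need not vanish here.\<close>
  have "x \<cdot> y = 0"
  proof (rule ccontr)
    assume nz: "x \<cdot> y \<noteq> 0"
    define t where "t = (x \<cdot> x + 1) / (2 * (x \<cdot> y))"
    have "0 \<le> (x - t *\<^sub>R y) \<cdot> (x - t *\<^sub>R y)"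
      by (rule ip_nonneg)
    also have "\<dots> = x \<cdot> x - 2 * t * (x \<cdot> y)"
      using True by (simp add: ip_linear ip_commute[of y x] algebra_simps)
    also have "\<dots> = -1"
      using nz by (simp add: t_def field_simps)
    finally show False by simp
  qed
  then show ?thesis by (simp add: True)
next
  case False
  then have pos: "0 < y \<cdot> y"
    using ip_nonneg[of y] by simp
  define t where "t = (x \<cdot> y) / (y \<cdot> y)"
  have "0 \<le> (x - t *\<^sub>R y) \<cdot> (x - t *\<^sub>R y)"
    by (rule ip_nonneg)
  also have "\<dots> = x \<cdot> x - 2 * t * (x \<cdot> y) + t * (t * (y \<cdot> y))"
    by (simp add: ip_linear ip_commute[of y x] algebra_simps)
  also have "t * (y \<cdot> y) = x \<cdot> y"
    using pos by (simp add: t_def)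
  finally have "t * (x \<cdot> y) \<le> x \<cdot> x"
    by simp
  then show ?thesis
    using pos by (simp add: t_def field_simps power2_eq_square)
qed

definition nrm :: "'v \<Rightarrow> real"
  where "nrm x = sqrt (x \<cdot> x)"

lemma nrm_nonneg [simp]: "0 \<le> nrm x"
  by (simp add: nrm_def ip_nonneg)

lemma nrm_square: "(nrm x)\<^sup>2 = x \<cdot> x"
  by (simp add: nrm_def ip_nonneg)

lemma nrm_leI: "x \<cdot> x \<le> r\<^sup>2 \<Longrightarrow> 0 \<le> r \<Longrightarrow> nrm x \<le> r"
  unfolding nrm_def by (rule real_le_lsqrt)

lemma Cauchy_Schwarz: "\<bar>x \<cdot> y\<bar> \<le> nrm x * nrm y"
proof -
  have "\<bar>x \<cdot> y\<bar> = sqrt ((x \<cdot> y)\<^sup>2)"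
    by simp
  also have "\<dots> \<le> sqrt ((x \<cdot> x) * (y \<cdot> y))"
    using Cauchy_Schwarz_square real_sqrt_le_mono by blast
  finally show ?thesis
    by (simp add: nrm_def real_sqrt_mult)
qed

lemma nrm_triangle: "nrm (x + y) \<le> nrm x + nrm y"
proof (rule nrm_leI)
  have "(x + y) \<cdot> (x + y) = (nrm x)\<^sup>2 + 2 * (x \<cdot> y) + (nrm y)\<^sup>2"
    by (simp add: nrm_square ip_linear ip_commute[of y x])
  also have "\<dots> \<le> (nrm x)\<^sup>2 + 2 * (nrm x * nrm y) + (nrm y)\<^sup>2"
    using Cauchy_Schwarz[of x y] by simp
  finally show "(x + y) \<cdot> (x + y) \<le> (nrm x + nrm y)\<^sup>2"
    by (simp add: power2_sum)
qed simp

lemma nrm_scaleR: "nrm (a *\<^sub>R x) = \<bar>a\<bar> * nrm x"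
  by (simp add: nrm_def ip_linear real_sqrt_mult flip: mult.assoc)

lemma nrm_diff_triangle: "nrm (x - y) \<le> nrm x + nrm y"
  using nrm_triangle[of x "(-1) *\<^sub>R y"] nrm_scaleR[of "-1" y] by simp

end

section \<open>The projection onto a unit vector plus a skew contraction\<close>

text \<open>
  Let \<open>M\<close> be the symmetric matrix with rows \<open>(m, f)\<close> and \<open>(f, k)\<close>. By hypothesis \<open>I - M\<close> is positive
  semidefinite; as \<open>M\<close> has nonnegative trace, both eigenvalues then lie in \<open>[-1, 1]\<close>. In the
  proof, \<open>I - M\<^sup>2\<close> is bounded below by the trace \<open>m + k\<close> times \<open>I - M\<close>, whose quadratic form is \<open>A - 2 * f * p * q\<close>.
\<close>

lemma symmetric_two_by_two_contraction:
  fixes m f k p q :: real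
  assumes det: "f\<^sup>2 \<le> (1 - m) * (1 - k)" and "0 \<le> m" "m \<le> 1" "0 \<le> k" "k \<le> 1"
  shows "(m * p + f * q)\<^sup>2 + (f * p + k * q)\<^sup>2 \<le> p\<^sup>2 + q\<^sup>2"
proof -
  define A where "A = (1 - m) * p\<^sup>2 + (1 - k) * q\<^sup>2"
  have A0: "0 \<le> A"
    using assms by (simp add: A_def)
  have "(2 * f * p * q)\<^sup>2 = 4 * (p\<^sup>2 * q\<^sup>2) * f\<^sup>2"
    by (simp add: power2_eq_square algebra_simps)
  also have "\<dots> \<le> 4 * (p\<^sup>2 * q\<^sup>2) * ((1 - m) * (1 - k))"
    by (rule mult_left_mono[OF det]) simp
  also have "\<dots> \<le> A\<^sup>2"
    using zero_le_power2[of "(1 - m) * p\<^sup>2 - (1 - k) * q\<^sup>2"]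
    by (simp add: A_def power2_eq_square algebra_simps)
  finally have "2 * f * p * q \<le> A"
    by (rule power2_le_imp_le[OF _ A0])
  then have cross: "(m + k) * (2 * f * p * q) \<le> (m + k) * A"
    using assms by (intro mult_left_mono) auto
  have d: "f\<^sup>2 * (p\<^sup>2 + q\<^sup>2) \<le> (1 - m) * (1 - k) * (p\<^sup>2 + q\<^sup>2)"
    by (rule mult_right_mono[OF det]) simp
  show ?thesis
    using cross d by (simp add: A_def power2_eq_square algebra_simps)
qed

locale skew_perturbation = semi_inner_product +
  fixes S :: "'a \<Rightarrow> 'a" and e :: 'a
  assumes S_add: "S (x + y) = S x + S y"
    and S_scaleR: "S (a *\<^sub>R x) = a *\<^sub>R S x"
    and S_skew: "S x \<cdot> y = - (x \<cdot> S y)"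
    and S_contraction: "S x \<cdot> S x \<le> (x \<cdot> x) / 2"
    and unit: "e \<cdot> e = 1"
begin

lemma S_minus: "S (- x) = - S x"
  using S_scaleR[of "-1" x] by simp

lemma S_diff: "S (x - y) = S x - S y"
  using S_add[of x "- y"] by (simp add: S_minus)

lemmas S_linear = S_add S_scaleR S_minus S_diff

lemma ip_S_self: "x \<cdot> S x = 0"
  using S_skew[of x x] ip_commute[of x "S x"] by simp

definition U :: "'a \<Rightarrow> 'a"
  where "U x = (e \<cdot> x) *\<^sub>R e + S x"

text \<open>
  Since \<open>J\<close> is symmetric and \<open>S\<close> is skew, the transpose of \<open>J + S\<close> is \<open>J + (- S)\<close>. Everything proved
  about \<open>U\<close> in this context therefore holds for the transpose as well.
\<close>

lemma transposed: "skew_perturbation ip (\<lambda>x. - S x) e"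
proof unfold_locales
  show "(- S x) \<cdot> (- S x) \<le> (x \<cdot> x) / 2" for x
    using S_contraction[of x] by (simp only: ip_minus_left ip_minus_right minus_minus)
qed (auto simp: S_linear ip_linear S_skew unit)

lemma U_adjoint: "U x \<cdot> y = x \<cdot> skew_perturbation.U ip (\<lambda>x. - S x) e y"
  unfolding U_def skew_perturbation.U_def[OF transposed]
  by (simp add: ip_linear S_skew ip_commute[of x e])

subsection \<open>The fourth power is a contraction\<close>

text \<open>
  Decompose the space as \<open>\<real> e \<oplus> e\<^sup>\<bottom>\<close> and let \<open>b = S e\<close>, which lies in \<open>e\<^sup>\<bottom>\<close>. Then \<open>U\<close> is the block
  matrix with rows \<open>(1, - b\<^sup>T)\<close> and \<open>(b, R)\<close>, where \<open>R\<close> is the compression of \<open>S\<close> to \<open>e\<^sup>\<bottom>\<close>, and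
  \<open>U\<^sup>2\<close> has rows \<open>(1 - \<sigma>, - (b - R b)\<^sup>T)\<close> and \<open>(b + R b, - E)\<close>, where \<open>E = b b\<^sup>T - R\<^sup>2\<close> is the
  compression of \<open>- S\<^sup>2\<close>. So \<open>E\<close> is symmetric with \<open>0 \<le> E \<le> 1/2\<close>. Below, \<open>col_vec = b + R b\<close>,
  \<open>row_vec = b - R b\<close>, \<open>corner = E\<close> and \<open>\<rho> = \<bar>R b\<bar>\<^sup>2\<close>.
\<close>

abbreviation \<sigma> where "\<sigma> \<equiv> S e \<cdot> S e"
definition col_vec where "col_vec = S e + S (S e) + \<sigma> *\<^sub>R e"
definition row_vec where "row_vec = S e - S (S e) - \<sigma> *\<^sub>R e"
definition corner where "corner z = (e \<cdot> S (S z)) *\<^sub>R e - S (S z)"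

lemma U_U_block:
  assumes "e \<cdot> z = 0"
  shows "U (U (\<alpha> *\<^sub>R e + z)) = (\<alpha> * (1 - \<sigma>) - row_vec \<cdot> z) *\<^sub>R e + (\<alpha> *\<^sub>R col_vec - corner z)"
proof -
  have 1: "e \<cdot> S z = - (S e \<cdot> z)"
    by (simp add: S_skew)
  have 2: "e \<cdot> S (S z) = S (S e) \<cdot> z"
    by (simp add: S_skew)
  show ?thesis
    unfolding U_def col_vec_def row_vec_def corner_def 2
    by (simp add: S_linear ip_linear 1 ip_S_self unit assms algebra_simps)
qed

lemma col_vec_orth: "e \<cdot> col_vec = 0"
  using S_skew[of e "S e"] by (simp add: col_vec_def ip_linear unit ip_S_self)

lemma corner_orth: "e \<cdot> corner z = 0"
  by (simp add: corner_def ip_linear unit)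

lemma corner_quadratic:
  assumes "e \<cdot> z = 0"
  shows "corner z \<cdot> z = S z \<cdot> S z"
  using assms S_skew[of "S z" z] by (simp add: corner_def ip_linear)

lemma corner_square: "corner z \<cdot> corner z \<le> S z \<cdot> S z / 2"
proof -
  have "corner z \<cdot> corner z = S (S z) \<cdot> S (S z) - (e \<cdot> S (S z))\<^sup>2"
    by (simp add: corner_def ip_linear unit power2_eq_square ip_commute[of "S (S z)" e])
  then show ?thesis
    using S_contraction[of "S z"] zero_le_power2[of "e \<cdot> S (S z)"] by linarith
qed

lemma nrm_corner: "nrm (corner z) \<le> nrm z / 2"
proof (rule nrm_leI)
  have "corner z \<cdot> corner z \<le> (z \<cdot> z) / 4"
    using corner_square[of z] S_contraction[of z] by simp
  then show "corner z \<cdot> corner z \<le> (nrm z / 2)\<^sup>2"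
    by (simp add: power_divide nrm_square)
qed simp

lemma \<sigma>_bounds: "0 \<le> \<sigma>" "\<sigma> \<le> 1/2"
  using ip_nonneg[of "S e"] S_contraction[of e] unit by auto

text \<open>
  Both \<open>\<sigma>\<close> and the symmetric operator \<open>E \<ge> 0\<close> are at most \<open>1/2\<close>, so \<open>(1 - \<sigma>) - E\<close> lies between \<open>0\<close>
  and \<open>1 - \<sigma>\<close>.
\<close>

lemma nrm_shifted_corner:
  assumes "e \<cdot> z = 0"
  shows "nrm ((1 - \<sigma>) *\<^sub>R z - corner z) \<le> (1 - \<sigma>) * nrm z"
proof (rule nrm_leI)
  have "((1 - \<sigma>) *\<^sub>R z - corner z) \<cdot> ((1 - \<sigma>) *\<^sub>R z - corner z)
      = (1 - \<sigma>)\<^sup>2 * (z \<cdot> z) - 2 * (1 - \<sigma>) * (S z \<cdot> S z) + corner z \<cdot> corner z"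
    using corner_quadratic[OF assms]
    by (simp add: ip_linear ip_commute[of z "corner z"] power2_eq_square algebra_simps)
  also have "\<dots> \<le> (1 - \<sigma>)\<^sup>2 * (z \<cdot> z)"
  proof -
    have "1 * (S z \<cdot> S z) \<le> 2 * (1 - \<sigma>) * (S z \<cdot> S z)"
      using \<sigma>_bounds by (intro mult_right_mono ip_nonneg) auto
    then show ?thesis
      using corner_square[of z] ip_nonneg[of "S z"] by linarith
  qed
  finally show "((1 - \<sigma>) *\<^sub>R z - corner z) \<cdot> ((1 - \<sigma>) *\<^sub>R z - corner z) \<le> ((1 - \<sigma>) * nrm z)\<^sup>2"
    by (simp add: power_mult_distrib nrm_square)
qed (use \<sigma>_bounds in simp)

definition \<rho> where "\<rho> = S (S e) \<cdot> S (S e) - \<sigma>\<^sup>2"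

lemma e_SSe: "e \<cdot> S (S e) = - \<sigma>"
  using S_skew[of e "S e"] by simp

lemma \<rho>_bounds: "0 \<le> \<rho>" "\<rho> \<le> \<sigma> / 2 - \<sigma>\<^sup>2"
proof -
  have "0 \<le> (S (S e) + \<sigma> *\<^sub>R e) \<cdot> (S (S e) + \<sigma> *\<^sub>R e)"
    by (rule ip_nonneg)
  also have "\<dots> = \<rho>"
    by (simp add: \<rho>_def ip_linear unit ip_commute[of "S (S e)" e] e_SSe power2_eq_square)
  finally show "0 \<le> \<rho>" .
  show "\<rho> \<le> \<sigma> / 2 - \<sigma>\<^sup>2"
    using S_contraction[of "S e"] by (simp add: \<rho>_def)
qed

lemma col_row_products: "col_vec \<cdot> col_vec = \<sigma> + \<rho>" "row_vec \<cdot> row_vec = \<sigma> + \<rho>" "row_vec \<cdot> col_vec = \<sigma> - \<rho>"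
  by (simp_all add: col_vec_def row_vec_def \<rho>_def ip_linear unit ip_commute[of "S e" e] ip_commute[of "S (S e)" e] e_SSe ip_S_self
      ip_commute[of "S (S e)" "S e"] power2_eq_square)

text \<open>
  Squaring the block form of \<open>U\<^sup>2\<close>, with \<open>F = (1 - \<sigma>) - E\<close>, \<open>c = b + R b\<close> and \<open>d = b - R b\<close>, gives
  for \<open>U\<^sup>4\<close> the rows \<open>(m, - (F d)\<^sup>T)\<close> and \<open>(F c, E\<^sup>2 - c d\<^sup>T)\<close>. The norms of the four blocks are at most
  \<open>m'\<close>, \<open>f\<close>, \<open>f\<close> and \<open>1/4 + g\<close>, all functions of \<open>\<sigma>\<close> alone, and these numbers form a contractive
  symmetric matrix for every \<open>\<sigma>\<close> in \<open>[0, 1/2]\<close>. For small \<open>\<sigma>\<close> what matters is that the decrease of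
  \<open>m'\<close> below \<open>1\<close> is linear in \<open>\<sigma>\<close> with a large enough slope.
\<close>

theorem nrm_U_pow_4: "nrm (U (U (U (U x)))) \<le> nrm x"
proof -
  define \<alpha> where "\<alpha> = e \<cdot> x"
  define z where "z = x - \<alpha> *\<^sub>R e"
  have x: "x = \<alpha> *\<^sub>R e + z"
    by (simp add: z_def)
  have z: "e \<cdot> z = 0"
    by (simp add: z_def \<alpha>_def ip_linear unit)
  define F where "F y = (1 - \<sigma>) *\<^sub>R y - corner y" for y
  define \<alpha>' where "\<alpha>' = \<alpha> * (1 - \<sigma>) - row_vec \<cdot> z"
  define z' where "z' = \<alpha> *\<^sub>R col_vec - corner z"
  have z': "e \<cdot> z' = 0"
    by (simp add: z'_def ip_linear col_vec_orth corner_orth)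
  define \<alpha>'' where "\<alpha>'' = \<alpha>' * (1 - \<sigma>) - row_vec \<cdot> z'"
  define z'' where "z'' = \<alpha>' *\<^sub>R col_vec - corner z'"
  have U4: "U (U (U (U x))) = \<alpha>'' *\<^sub>R e + z''"
    unfolding x U_U_block[OF z] \<alpha>'_def[symmetric] z'_def[symmetric]
    unfolding U_U_block[OF z'] \<alpha>''_def z''_def ..
  have z'': "e \<cdot> z'' = 0"
    by (simp add: z''_def ip_linear col_vec_orth corner_orth)
  define m where "m = (1 - \<sigma>)\<^sup>2 - \<sigma> + \<rho>"
  define m' where "m' = 1 - 5/2 * \<sigma> + 2 * \<sigma>\<^sup>2"
  define g where "g = \<sigma> * (3/2 - \<sigma>)"
  define f where "f = (1 - \<sigma>) * sqrt g"
  have g0: "0 \<le> g"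
    using \<sigma>_bounds by (simp add: g_def)
  have col_vec: "nrm col_vec \<le> sqrt g" and row_vec: "nrm row_vec \<le> sqrt g"
    using \<rho>_bounds by (auto simp: nrm_def col_row_products g_def power2_eq_square algebra_simps)
  have \<alpha>''_eq: "\<alpha>'' = m * \<alpha> - row_vec \<cdot> F z"
    by (simp add: \<alpha>''_def \<alpha>'_def z'_def m_def F_def ip_linear col_row_products power2_eq_square
        algebra_simps)
  have z''_eq: "z'' = \<alpha> *\<^sub>R F col_vec - (row_vec \<cdot> z) *\<^sub>R col_vec + corner (corner z)"
    by (simp add: z''_def \<alpha>'_def z'_def F_def corner_def S_linear ip_linear algebra_simps)
  \<comment> \<open>The term \<open>2 * \<sigma>\<^sup>2\<close> of \<open>m'\<close> is there because \<open>m\<close> is negative for \<open>\<sigma>\<close> near \<open>1/2\<close>; with it the bound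
     on \<open>- m\<close> factors as below.\<close>
  have "\<bar>m\<bar> \<le> m'"
  proof -
    have "0 \<le> (1/2 - \<sigma>) * (4/3 - \<sigma>)"
      using \<sigma>_bounds by simp
    then have "11 * \<sigma> \<le> 4 + 6 * \<sigma>\<^sup>2"
      by (simp add: power2_eq_square algebra_simps)
    moreover have "m = 1 - 3 * \<sigma> + \<sigma>\<^sup>2 + \<rho>"
      by (simp add: m_def power2_diff)
    ultimately show ?thesis
      using \<rho>_bounds zero_le_power2[of \<sigma>] unfolding m'_def abs_le_iff by linarith
  qed
  have "\<bar>row_vec \<cdot> F z\<bar> \<le> nrm row_vec * nrm (F z)"
    by (rule Cauchy_Schwarz)
  also have "\<dots> \<le> sqrt g * ((1 - \<sigma>) * nrm z)"
    unfolding F_def using row_vec nrm_shifted_corner[OF z] g0 by (intro mult_mono) auto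
  finally have dF: "\<bar>row_vec \<cdot> F z\<bar> \<le> f * nrm z"
    by (simp add: f_def mult_ac)
  have "\<bar>\<alpha>''\<bar> \<le> \<bar>m\<bar> * \<bar>\<alpha>\<bar> + \<bar>row_vec \<cdot> F z\<bar>"
    unfolding \<alpha>''_eq by (simp add: abs_mult[symmetric])
  also have "\<dots> \<le> m' * \<bar>\<alpha>\<bar> + f * nrm z"
    using dF \<open>\<bar>m\<bar> \<le> m'\<close> by (intro add_mono mult_right_mono) auto
  finally have row1: "\<bar>\<alpha>''\<bar> \<le> m' * \<bar>\<alpha>\<bar> + f * nrm z" .
  have Fc: "nrm (F col_vec) \<le> f"
  proof -
    have "nrm (F col_vec) \<le> (1 - \<sigma>) * nrm col_vec"
      unfolding F_def by (rule nrm_shifted_corner[OF col_vec_orth])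
    also have "\<dots> \<le> f"
      unfolding f_def using col_vec \<sigma>_bounds by (intro mult_left_mono) auto
    finally show ?thesis .
  qed
  have dz: "\<bar>row_vec \<cdot> z\<bar> * nrm col_vec \<le> g * nrm z"
  proof -
    have "\<bar>row_vec \<cdot> z\<bar> * nrm col_vec \<le> (sqrt g * nrm z) * sqrt g"
      using Cauchy_Schwarz[of row_vec z] mult_right_mono[OF row_vec, of "nrm z"] col_vec
      by (intro mult_mono) (auto simp: g0)
    then show ?thesis
      using g0 by (simp add: mult_ac flip: mult.assoc[of "sqrt g" "sqrt g"])
  qed
  have EE: "nrm (corner (corner z)) \<le> nrm z / 4"
    using nrm_corner[of "corner z"] nrm_corner[of z] by simp
  have "nrm z'' \<le> nrm (\<alpha> *\<^sub>R F col_vec) + nrm ((row_vec \<cdot> z) *\<^sub>R col_vec) + nrm (corner (corner z))"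
    unfolding z''_eq by (meson add_right_mono nrm_diff_triangle nrm_triangle order_trans)
  also have "\<dots> \<le> \<bar>\<alpha>\<bar> * f + g * nrm z + nrm z / 4"
    unfolding nrm_scaleR using dz EE Fc by (intro add_mono mult_left_mono) auto
  finally have row2: "nrm z'' \<le> f * \<bar>\<alpha>\<bar> + (1/4 + g) * nrm z"
    by (simp add: algebra_simps)
  have "(nrm (U (U (U (U x)))))\<^sup>2 = \<bar>\<alpha>''\<bar>\<^sup>2 + (nrm z'')\<^sup>2"
    using z'' unfolding U4 nrm_square
    by (simp add: ip_linear unit ip_commute[of z'' e] power2_eq_square)
  also have "\<dots> \<le> (m' * \<bar>\<alpha>\<bar> + f * nrm z)\<^sup>2 + (f * \<bar>\<alpha>\<bar> + (1/4 + g) * nrm z)\<^sup>2"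
    using row1 row2 by (intro add_mono power_mono) auto
  also have "\<dots> \<le> \<bar>\<alpha>\<bar>\<^sup>2 + (nrm z)\<^sup>2"
  proof (rule symmetric_two_by_two_contraction)
    have s3: "\<sigma> * \<sigma>\<^sup>2 \<le> 1/2 * \<sigma>\<^sup>2"
      using \<sigma>_bounds by (intro mult_right_mono) auto
    \<comment> \<open>The determinant condition, divided by \<open>\<sigma>\<close>, is a cubic inequality; bounding \<open>\<sigma>\<^sup>3\<close> by \<open>\<sigma>\<^sup>2 / 2\<close> turns it
       into a quadratic one with negative discriminant.\<close>
    have "0 \<le> 3/8 - 5/4 * \<sigma> + 3/2 * \<sigma>\<^sup>2"
      using zero_le_power2[of "\<sigma> - 5/12"] by (simp add: power2_eq_square algebra_simps)
    then have "0 \<le> 3/8 - 5/4 * \<sigma> + 2 * \<sigma>\<^sup>2 - \<sigma> * \<sigma>\<^sup>2"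
      using s3 by simp
    then have "0 \<le> \<sigma> * (3/8 - 5/4 * \<sigma> + 2 * \<sigma>\<^sup>2 - \<sigma> * \<sigma>\<^sup>2)"
      using \<sigma>_bounds by simp
    moreover have "f\<^sup>2 = (1 - \<sigma>)\<^sup>2 * g"
      using g0 by (simp add: f_def power_mult_distrib)
    moreover have "(1 - m') * (1 - (1/4 + g)) - (1 - \<sigma>)\<^sup>2 * g
        = \<sigma> * (3/8 - 5/4 * \<sigma> + 2 * \<sigma>\<^sup>2 - \<sigma> * \<sigma>\<^sup>2)"
      by (simp add: m'_def g_def power2_eq_square field_simps)
    ultimately show "f\<^sup>2 \<le> (1 - m') * (1 - (1/4 + g))"
      by linarith
    show "0 \<le> m'"
      using \<open>\<bar>m\<bar> \<le> m'\<close> by simp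
    have "0 \<le> \<sigma> * (5/2 - 2 * \<sigma>)"
      using \<sigma>_bounds by simp
    then show "m' \<le> 1"
      by (simp add: m'_def power2_eq_square algebra_simps)
    show "1/4 + g \<le> 1"
      using mult_mono[of \<sigma> "1/2" "3/2 - \<sigma>" "3/2"] \<sigma>_bounds by (simp add: g_def)
  qed (use g0 in simp)
  also have "\<dots> = (nrm x)\<^sup>2"
    using z unfolding nrm_square x
    by (simp add: ip_linear unit ip_commute[of z e] power2_eq_square)
  finally show ?thesis
    by (rule power2_le_imp_le) simp
qed


subsection \<open>Powers applied to the unit vector\<close>

text \<open>
  Moving powers of \<open>S\<close> across the inner product leaves only the numbers \<open>\<bar>S\<^sup>k e\<bar>\<^sup>2\<close>: the Gram
  matrix of \<open>e, S e, S\<^sup>2 e, \<dots>\<close> vanishes at odd distance from the diagonal.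
\<close>

lemma S_moments:
  "x \<cdot> S x = 0" "S x \<cdot> x = 0"
  "x \<cdot> S (S x) = - (S x \<cdot> S x)" "S (S x) \<cdot> x = - (S x \<cdot> S x)"
  "x \<cdot> S (S (S x)) = 0" "S (S (S x)) \<cdot> x = 0"
  "x \<cdot> S (S (S (S x))) = S (S x) \<cdot> S (S x)" "S (S (S (S x))) \<cdot> x = S (S x) \<cdot> S (S x)"
  "x \<cdot> S (S (S (S (S x)))) = 0" "S (S (S (S (S x)))) \<cdot> x = 0"
proof -
  have move: "x \<cdot> S y = - (S x \<cdot> y)" for x y
    by (simp add: S_skew)
  show 1: "x \<cdot> S x = 0" "x \<cdot> S (S x) = - (S x \<cdot> S x)" "x \<cdot> S (S (S x)) = 0"
    "x \<cdot> S (S (S (S x))) = S (S x) \<cdot> S (S x)" "x \<cdot> S (S (S (S (S x)))) = 0"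
    using move[of x "S x"] move[of x "S (S x)"] move[of x "S (S (S x))"]
      move[of "S x" "S (S x)"] move[of x "S (S (S (S x)))"] move[of "S x" "S (S (S x))"]
    by (simp_all add: ip_S_self)
  show "S x \<cdot> x = 0" "S (S x) \<cdot> x = - (S x \<cdot> S x)" "S (S (S x)) \<cdot> x = 0"
    "S (S (S (S x))) \<cdot> x = S (S x) \<cdot> S (S x)" "S (S (S (S (S x)))) \<cdot> x = 0"
    using 1 ip_commute by metis+
qed

lemma nrm_le_1_iff: "nrm x \<le> 1 \<longleftrightarrow> x \<cdot> x \<le> 1"
  by (simp add: nrm_def)

lemma U_pow_unit:
  "U e = e + S e"
  "U (U e) = e + S e + S (S e)"
  "U (U (U e)) = (1 - \<sigma>) *\<^sub>R e + S e + S (S e) + S (S (S e))"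
  by (simp_all add: U_def ip_linear S_linear S_moments unit algebra_simps)

lemma U_pow_5_unit:
  "U (U (U (U (U e)))) = (1 - 3 * \<sigma> + S (S e) \<cdot> S (S e)) *\<^sub>R e + (1 - 2 * \<sigma>) *\<^sub>R S e
     + (1 - \<sigma>) *\<^sub>R S (S e) + S (S (S e)) + S (S (S (S e))) + S (S (S (S (S e))))"
  unfolding U_pow_unit
  by (simp add: U_def ip_linear S_linear S_moments unit algebra_simps)

lemma nrm_U_pow_2_unit: "nrm (U (U e)) \<le> 1"
  using S_contraction[of "S e"] ip_nonneg[of "S e"]
  by (simp add: nrm_le_1_iff U_pow_unit(2) ip_linear S_moments unit)

lemma nrm_U_pow_3_unit: "nrm (U (U (U e))) \<le> 1"
proof -
  have "U (U (U e)) \<cdot> U (U (U e)) = 1 - 3 * \<sigma> * (1 - \<sigma>) - S (S e) \<cdot> S (S e) + S (S (S e)) \<cdot> S (S (S e))"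
    by (simp add: U_pow_unit(3) ip_linear S_moments unit algebra_simps)
  moreover have "0 \<le> \<sigma> * (1 - \<sigma>)"
    using \<sigma>_bounds by simp
  ultimately show ?thesis
    unfolding nrm_le_1_iff using S_contraction[of "S (S e)"] ip_nonneg[of "S (S e)"] by linarith
qed

text \<open>
  The squared norm is a polynomial in \<open>s = \<bar>S e\<bar>\<^sup>2\<close>, \<open>t = \<bar>S\<^sup>2 e\<bar>\<^sup>2\<close>, \<dots>, and each of these numbers is
  at most half of the one before. Eliminating them from the highest on leaves an inequality in \<open>s\<close>
  and \<open>t\<close>, convex in \<open>t\<close>, which has to be checked only at \<open>t = 0\<close> and \<open>t = s / 2\<close>; the case distinction
  does this.
\<close>

lemma nrm_U_pow_5_unit: "nrm (U (U (U (U (U e))))) \<le> 1"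
proof -
  define s where "s = \<sigma>"
  define t where "t = S (S e) \<cdot> S (S e)"
  define u where "u = S (S (S e)) \<cdot> S (S (S e))"
  define v where "v = S (S (S (S e))) \<cdot> S (S (S (S e)))"
  define w where "w = S (S (S (S (S e)))) \<cdot> S (S (S (S (S e))))"
  have bounds: "0 \<le> s" "s \<le> 1/2" "0 \<le> t" "t \<le> s / 2" "u \<le> t / 2" "0 \<le> v" "w \<le> v / 2"
    unfolding s_def t_def u_def v_def w_def
    using \<sigma>_bounds S_contraction ip_nonneg by auto
  have "U (U (U (U (U e)))) \<cdot> U (U (U (U (U e)))) =
      (1 - 3 * s + t)\<^sup>2 - 2 * s * (1 - s) * (1 - 3 * s + t) + s * (1 - 2 * s)\<^sup>2
      + t * ((1 - s)\<^sup>2 + 2 * (1 - 3 * s + t) - 2 * (1 - 2 * s)) + u * (1 - 2 * s) + w - v"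
    unfolding U_pow_5_unit s_def t_def u_def v_def w_def
    by (simp add: ip_linear S_moments unit power2_eq_square algebra_simps)
  also have "\<dots> \<le> (1 - 3 * s + t)\<^sup>2 - 2 * s * (1 - s) * (1 - 3 * s + t) + s * (1 - 2 * s)\<^sup>2
      + t * ((1 - s)\<^sup>2 + 2 * (1 - 3 * s + t) - 2 * (1 - 2 * s)) + t / 2 * (1 - 2 * s)"
    using mult_right_mono[of u "t / 2" "1 - 2 * s"] bounds by simp
  also have "\<dots> = 1 - s * (7 - 13 * s + 2 * s\<^sup>2) + t * (7/2 - 13 * s + 3 * s\<^sup>2 + 3 * t)"
    by (simp add: power2_eq_square algebra_simps)
  also have "\<dots> \<le> 1"
  proof -
    have "t * (7/2 - 13 * s + 3 * s\<^sup>2 + 3 * t) \<le> t * (7/2 - 13 * s + 3 * s\<^sup>2 + 3 * (s / 2))"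
      using bounds by (intro mult_left_mono) auto
    also have "\<dots> \<le> s * (7 - 13 * s + 2 * s\<^sup>2)"
    proof (cases "0 \<le> 7/2 - 13 * s + 3 * s\<^sup>2 + 3 * (s / 2)")
      case True
      have "t * (7/2 - 13 * s + 3 * s\<^sup>2 + 3 * (s / 2)) \<le> s / 2 * (7/2 - 13 * s + 3 * s\<^sup>2 + 3 * (s / 2))"
        using True bounds by (intro mult_right_mono) auto
      also have "\<dots> = s * (7/4 - 23/4 * s + 3/2 * s\<^sup>2)"
        by (simp add: power2_eq_square algebra_simps)
      also have "\<dots> \<le> s * (7 - 13 * s + 2 * s\<^sup>2)"
        using bounds zero_le_power2[of s] by (intro mult_left_mono) linarith+
      finally show ?thesis .
    next
      case False
      then have "t * (7/2 - 13 * s + 3 * s\<^sup>2 + 3 * (s / 2)) \<le> 0"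
        using bounds by (intro mult_nonneg_nonpos) auto
      moreover have "0 \<le> s * (7 - 13 * s + 2 * s\<^sup>2)"
        using bounds zero_le_power2[of s] by (intro mult_nonneg_nonneg) linarith+
      ultimately show ?thesis by linarith
    qed
    finally show ?thesis by simp
  qed
  finally show ?thesis
    unfolding nrm_le_1_iff .
qed

lemma U_pow_4_add: "(U ^^ (n + 4)) x = U (U (U (U ((U ^^ n) x))))"
  by (simp add: eval_nat_numeral)

lemma nrm_U_pow_multiple_of_4:
  assumes "4 dvd n"
  shows "nrm ((U ^^ n) x) \<le> nrm x"
proof -
  obtain k where "n = 4 * k"
    using assms by blast
  moreover have "nrm ((U ^^ (4 * k)) x) \<le> nrm x"
  proof (induction k)
    case (Suc k)
    have "nrm ((U ^^ (4 * Suc k)) x) = nrm ((U ^^ (4 * k + 4)) x)"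
      by (simp add: algebra_simps)
    also have "\<dots> \<le> nrm ((U ^^ (4 * k)) x)"
      unfolding U_pow_4_add by (rule nrm_U_pow_4)
    finally show ?case using Suc by linarith
  qed simp
  ultimately show ?thesis by simp
qed

text \<open>
  Every exponent other than \<open>1\<close> is \<open>0\<close>, \<open>2\<close>, \<open>3\<close> or \<open>5\<close> plus a multiple of four, and four further
  factors do not increase the norm.
\<close>

theorem nrm_U_pow_unit:
  assumes "n \<noteq> 1"
  shows "nrm ((U ^^ n) e) \<le> 1"
  using assms
proof (induction n rule: less_induct)
  case (less n)
  consider "n = 0" | "n = 2" | "n = 3" | "n = 4" | "n = 5" | m where "n = m + 4" "2 \<le> m"
  proof -
    have "n \<in> {0, 2, 3, 4, 5} \<or> n = (n - 4) + 4 \<and> 2 \<le> n - 4"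
      using less.prems by auto
    then show thesis using that by blast
  qed
  then show ?case
  proof cases
    case 6
    have "nrm ((U ^^ n) e) \<le> nrm ((U ^^ m) e)"
      unfolding 6 U_pow_4_add by (rule nrm_U_pow_4)
    also have "\<dots> \<le> 1"
      using less.IH[of m] 6 by simp
    finally show ?thesis .
  qed (use unit nrm_U_pow_4[of e] nrm_U_pow_2_unit nrm_U_pow_3_unit nrm_U_pow_5_unit
      in \<open>simp_all add: nrm_def eval_nat_numeral\<close>)
qed

subsection \<open>Products over a sequence of directions\<close>

definition step :: "bool \<Rightarrow> 'a \<Rightarrow> 'a"
  where "step d = (if d then U else skew_perturbation.U ip (\<lambda>x. - S x) e)"

lemma step_adjoint: "step d x \<cdot> y = x \<cdot> step (\<not> d) y"
  using U_adjoint[of x y] U_adjoint[of y x] by (auto simp: step_def ip_commute)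

lemma step_pow_adjoint: "(step d ^^ n) x \<cdot> y = x \<cdot> (step (\<not> d) ^^ n) y"
  by (induction n arbitrary: x y) (simp_all add: step_adjoint funpow_swap1)

lemma nrm_step_pow_multiple_of_4: "4 dvd n \<Longrightarrow> nrm ((step d ^^ n) x) \<le> nrm x"
  using nrm_U_pow_multiple_of_4 skew_perturbation.nrm_U_pow_multiple_of_4[OF transposed]
  by (simp add: step_def)

lemma nrm_step_pow_unit: "n \<noteq> 1 \<Longrightarrow> nrm ((step d ^^ n) e) \<le> 1"
  using nrm_U_pow_unit skew_perturbation.nrm_U_pow_unit[OF transposed]
  by (simp add: step_def)

end

definition run :: "'c list \<Rightarrow> nat \<Rightarrow> nat \<Rightarrow> bool" where
  "run ds i j \<longleftrightarrow> i < j \<and> j \<le> length ds \<and> (\<forall>t \<in> {i..<j}. ds ! t = ds ! i) \<and>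
     (0 < i \<longrightarrow> ds ! (i - 1) \<noteq> ds ! i) \<and> (j < length ds \<longrightarrow> ds ! j \<noteq> ds ! i)"

lemma runD:
  assumes "run ds i j"
  shows "i < j" "j \<le> length ds" "ds ! (j - 1) = ds ! i" "j < length ds \<Longrightarrow> ds ! j \<noteq> ds ! i"
    "0 < i \<Longrightarrow> ds ! (i - 1) \<noteq> ds ! i" "t \<in> {i..<j} \<Longrightarrow> ds ! t = ds ! i"
proof -
  show "i < j" "j \<le> length ds" "j < length ds \<Longrightarrow> ds ! j \<noteq> ds ! i"
    "0 < i \<Longrightarrow> ds ! (i - 1) \<noteq> ds ! i" "t \<in> {i..<j} \<Longrightarrow> ds ! t = ds ! i"
    using assms unfolding run_def by blast+
  have "j - 1 \<in> {i..<j}"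
    using \<open>i < j\<close> by simp
  then show "ds ! (j - 1) = ds ! i"
    using assms unfolding run_def by blast
qed

lemma run_from:
  assumes "i < length ds" and start: "0 < i \<longrightarrow> ds ! (i - 1) \<noteq> ds ! i"
  obtains j where "run ds i j" "drop i ds = replicate (j - i) (ds ! i) @ drop j ds"
proof -
  define n where "n = length (takeWhile (\<lambda>d. d = ds ! i) (drop i ds))"
  have le: "n \<le> length ds - i"
    unfolding n_def using length_takeWhile_le[of _ "drop i ds"] by simp
  have nth: "ds ! (i + t) = ds ! i" if "t < n" for t
  proof -
    have "takeWhile (\<lambda>d. d = ds ! i) (drop i ds) ! t = drop i ds ! t"
      using that unfolding n_def by (rule takeWhile_nth)
    moreover have "takeWhile (\<lambda>d. d = ds ! i) (drop i ds) ! t = ds ! i"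
      using set_takeWhileD[OF nth_mem[OF that[unfolded n_def]]] by simp
    ultimately show ?thesis using assms(1) by simp
  qed
  have "0 < n"
    unfolding n_def using assms(1) by (simp add: Cons_nth_drop_Suc[symmetric])
  then have bounds: "i < i + n" "i + n \<le> length ds"
    using le assms(1) by auto
  have "ds ! (i + n) \<noteq> ds ! i" if "i + n < length ds"
    using nth_length_takeWhile[of "\<lambda>d. d = ds ! i" "drop i ds"] that assms(1)
    unfolding n_def by simp
  moreover have "ds ! t = ds ! i" if "t \<in> {i..<i + n}" for t
    using nth[of "t - i"] that by auto
  ultimately have "run ds i (i + n)"
    unfolding run_def using bounds start by blast
  moreover have "takeWhile (\<lambda>d. d = ds ! i) (drop i ds) = replicate n (ds ! i)"
    unfolding n_def by (rule replicate_eqI[symmetric, THEN sym]) (auto dest: set_takeWhileD)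
  then have "drop i ds = replicate (i + n - i) (ds ! i) @ drop (i + n) ds"
    by (metis add.commute add_diff_cancel_left' drop_drop dropWhile_eq_drop n_def takeWhile_dropWhile_id)
  ultimately show ?thesis by (rule that)
qed

lemma foldr_replicate: "foldr f (replicate n a) x = (f a ^^ n) x"
  by (induction n) simp_all

context skew_perturbation
begin

text \<open>
  Induction from the right, one run at a time: the last run acts on \<open>e\<close> itself, every other run that
  does not start the sequence is internal and hence a contraction.
\<close>

lemma nrm_suffix:
  assumes long: "\<And>i j. run ds i j \<Longrightarrow> 2 \<le> j - i"
    and inner: "\<And>i j. run ds i j \<Longrightarrow> 0 < i \<Longrightarrow> j < length ds \<Longrightarrow> 4 dvd j - i"
    and "0 < i" "i < length ds" "ds ! (i - 1) \<noteq> ds ! i"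
  shows "nrm (foldr step (drop i ds) e) \<le> 1"
  using assms(3-)
proof (induction "length ds - i" arbitrary: i rule: less_induct)
  case less
  obtain j where j: "run ds i j" "drop i ds = replicate (j - i) (ds ! i) @ drop j ds"
    using run_from[of i ds] less.prems by auto
  have eq: "foldr step (drop i ds) e = (step (ds ! i) ^^ (j - i)) (foldr step (drop j ds) e)"
    unfolding j(2) by (simp add: foldr_replicate)
  show ?case
  proof (cases "j < length ds")
    case True
    have "nrm (foldr step (drop i ds) e) \<le> nrm (foldr step (drop j ds) e)"
      unfolding eq using inner[OF j(1) _ True] less.prems
      by (intro nrm_step_pow_multiple_of_4) auto
    also have "\<dots> \<le> 1"
    proof (rule less.hyps)
      show "ds ! (j - 1) \<noteq> ds ! j"
        using runD[OF j(1)] True by metis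
    qed (use runD(1,2)[OF j(1)] True in auto)
    finally show ?thesis .
  next
    case False
    then show ?thesis
      using long[OF j(1)] unfolding eq by (simp add: nrm_step_pow_unit)
  qed
qed

text \<open>
  The first run need not be a contraction. It is moved to the other side of the inner product, where it
  acts on \<open>e\<close>.
\<close>

theorem walk_form_le_1:
  assumes long: "\<And>i j. run ds i j \<Longrightarrow> 2 \<le> j - i"
    and inner: "\<And>i j. run ds i j \<Longrightarrow> 0 < i \<Longrightarrow> j < length ds \<Longrightarrow> 4 dvd j - i"
  shows "e \<cdot> foldr step ds e \<le> 1"
proof (cases "ds = []")
  case True
  then show ?thesis by (simp add: unit)
next
  case False
  then obtain j where j: "run ds 0 j" "drop 0 ds = replicate (j - 0) (ds ! 0) @ drop j ds"
    using run_from[of 0 ds] by auto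
  have rest: "nrm (foldr step (drop j ds) e) \<le> 1"
  proof (cases "j < length ds")
    case True
    have "ds ! (j - 1) \<noteq> ds ! j"
      using runD[OF j(1)] True by metis
    then show ?thesis
      using nrm_suffix[OF assms, where i = j] runD(1)[OF j(1)] True by blast
  next
    case False
    then show ?thesis by (simp add: nrm_def unit)
  qed
  have "e \<cdot> foldr step ds e = (step (\<not> ds ! 0) ^^ j) e \<cdot> foldr step (drop j ds) e"
    using j(2) by (simp add: foldr_replicate step_pow_adjoint) (metis foldr_append foldr_replicate o_apply)
  also have "\<dots> \<le> nrm ((step (\<not> ds ! 0) ^^ j) e) * nrm (foldr step (drop j ds) e)"
    using Cauchy_Schwarz abs_le_D1 by blast
  also have "\<dots> \<le> 1 * 1"
    using rest long[OF j(1)] by (intro mult_mono nrm_step_pow_unit) auto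
  finally show ?thesis by simp
qed

end

section \<open>Operators with a skew kernel on a finite set\<close>

instantiation "fun" :: (type, real_vector) real_vector
begin

definition scaleR_fun :: "real \<Rightarrow> ('a \<Rightarrow> 'b) \<Rightarrow> 'a \<Rightarrow> 'b"
  where "scaleR_fun a f = (\<lambda>x. a *\<^sub>R f x)"

instance
  by standard (auto simp: scaleR_fun_def fun_eq_iff scaleR_add_right scaleR_add_left)

end

text \<open>
  Averaging over \<open>V\<close> makes the constant function \<open>1\<close> a unit vector and the all-ones kernel the
  projection onto it.
\<close>

definition avg_ip :: "'b set \<Rightarrow> ('b \<Rightarrow> real) \<Rightarrow> ('b \<Rightarrow> real) \<Rightarrow> real"
  where "avg_ip V f g = (\<Sum>v\<in>V. f v * g v) / card V"

definition kernel_op :: "('b \<Rightarrow> 'b \<Rightarrow> real) \<Rightarrow> 'b set \<Rightarrow> ('b \<Rightarrow> real) \<Rightarrow> 'b \<Rightarrow> real"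
  where "kernel_op s V f = (\<lambda>v. (\<Sum>u\<in>V. s v u * f u) / card V)"

lemma semi_inner_product_avg_ip: "semi_inner_product (avg_ip V)"
  by unfold_locales
    (auto simp: avg_ip_def scaleR_fun_def algebra_simps sum.distrib sum_distrib_left add_divide_distrib
      intro!: divide_nonneg_nonneg sum_nonneg)

lemma sum_Cauchy_Schwarz:
  fixes f g :: "'b \<Rightarrow> real"
  assumes "finite I"
  shows "(\<Sum>i\<in>I. f i * g i)\<^sup>2 \<le> (\<Sum>i\<in>I. f i * f i) * (\<Sum>i\<in>I. g i * g i)"
proof (cases "I = {}")
  case False
  then have "0 < real (card I)"
    using assms by (simp add: card_gt_0_iff)
  then show ?thesis
    using semi_inner_product.Cauchy_Schwarz_square[OF semi_inner_product_avg_ip[of I], of f g]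
    by (simp add: avg_ip_def power2_eq_square field_simps)
qed simp

text \<open>
  Let \<open>g\<close> be the image of \<open>f\<close>. By skewness, \<open>2 (g \<cdot> S f)\<close> is the inner product of \<open>s\<close> with the
  alternating kernel \<open>h v u = g v f u - g u f v\<close>. As \<open>h\<close> has squared norm at most
  \<open>2 \<bar>f\<bar>\<^sup>2 \<bar>g\<bar>\<^sup>2\<close> and \<open>s\<close> has norm at most \<open>1\<close>, the Cauchy-Schwarz inequality for kernels gives
  \<open>4 \<bar>g\<bar>\<^sup>4 \<le> 2 \<bar>f\<bar>\<^sup>2 \<bar>g\<bar>\<^sup>2\<close>. Without skewness one would lose the factor \<open>1/2\<close>.
\<close>

lemma kernel_op_contraction:
  assumes fin: "finite V" and skew: "\<And>v u. s v u = - s u v" and bound: "\<And>v u. \<bar>s v u\<bar> \<le> 1"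
  shows "avg_ip V (kernel_op s V f) (kernel_op s V f) \<le> avg_ip V f f / 2"
proof (cases "V = {}")
  case False
  then have N: "0 < real (card V)"
    using fin by (simp add: card_gt_0_iff)
  define g where "g = kernel_op s V f"
  define G where "G = (\<Sum>v\<in>V. g v * g v)"
  define F where "F = (\<Sum>v\<in>V. f v * f v)"
  define X where "X = (\<Sum>v\<in>V. \<Sum>u\<in>V. s v u * (g v * f u))"
  define h where "h v u = g v * f u - g u * f v" for v u
  have NG: "card V * G = X"
  proof -
    have "card V * G = (\<Sum>v\<in>V. g v * (card V * g v))"
      by (simp add: G_def sum_distrib_left mult_ac)
    also have "\<dots> = (\<Sum>v\<in>V. g v * (\<Sum>u\<in>V. s v u * f u))"
      using N by (simp add: g_def kernel_op_def)
    finally show ?thesis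
      by (simp add: X_def sum_distrib_left mult_ac)
  qed
  have "X = (\<Sum>v\<in>V. \<Sum>u\<in>V. s u v * (g u * f v))"
    unfolding X_def by (rule sum.swap)
  also have "\<dots> = - (\<Sum>v\<in>V. \<Sum>u\<in>V. s v u * (g u * f v))"
    unfolding sum_negf[symmetric] by (intro sum.cong refl) (subst skew, simp)
  finally have "2 * X = (\<Sum>v\<in>V. \<Sum>u\<in>V. s v u * h v u)"
    by (simp add: X_def h_def right_diff_distrib sum_subtractf)
  then have X2: "2 * X = (\<Sum>p\<in>V \<times> V. case_prod s p * case_prod h p)"
    by (simp add: sum.cartesian_product case_prod_unfold)
  have "(\<Sum>p\<in>V \<times> V. case_prod s p * case_prod s p) \<le> (\<Sum>p\<in>V \<times> V. 1)"
  proof (rule sum_mono)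
    fix p :: "'a \<times> 'a"
    have "\<bar>case_prod s p\<bar> * \<bar>case_prod s p\<bar> \<le> 1"
      using bound[of "fst p" "snd p"] by (intro mult_le_one) (auto simp: case_prod_unfold)
    then show "case_prod s p * case_prod s p \<le> 1" by simp
  qed
  then have s2: "(\<Sum>p\<in>V \<times> V. case_prod s p * case_prod s p) \<le> (card V)\<^sup>2"
    by (simp add: power2_eq_square card_cartesian_product)
  have "(\<Sum>p\<in>V \<times> V. case_prod h p * case_prod h p) = (\<Sum>v\<in>V. \<Sum>u\<in>V. h v u * h v u)"
    by (simp add: sum.cartesian_product case_prod_unfold)
  also have "\<dots> = (\<Sum>v\<in>V. \<Sum>u\<in>V. (g v * g v) * (f u * f u))
      + (\<Sum>v\<in>V. \<Sum>u\<in>V. (f v * f v) * (g u * g u))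
      - 2 * (\<Sum>v\<in>V. \<Sum>u\<in>V. (g v * f v) * (g u * f u))"
    by (simp add: h_def algebra_simps sum.distrib sum_subtractf sum_distrib_left)
  also have "\<dots> = 2 * (G * F) - 2 * (\<Sum>v\<in>V. g v * f v)\<^sup>2"
    by (simp add: G_def F_def power2_eq_square flip: sum_product)
  also have "\<dots> \<le> 2 * (G * F)"
    by simp
  finally have h2: "(\<Sum>p\<in>V \<times> V. case_prod h p * case_prod h p) \<le> 2 * (G * F)" .
  have "(2 * (card V * G))\<^sup>2 \<le> (card V)\<^sup>2 * (2 * (G * F))"
  proof -
    have "(2 * X)\<^sup>2 \<le> (\<Sum>p\<in>V \<times> V. case_prod s p * case_prod s p)
        * (\<Sum>p\<in>V \<times> V. case_prod h p * case_prod h p)"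
      unfolding X2 using fin by (intro sum_Cauchy_Schwarz) simp
    also have "\<dots> \<le> (card V)\<^sup>2 * (2 * (G * F))"
      using s2 h2 by (intro mult_mono sum_nonneg) auto
    finally show ?thesis unfolding NG .
  qed
  then have "(2 * (real (card V))\<^sup>2) * (2 * G * G) \<le> (2 * (real (card V))\<^sup>2) * (F * G)"
    by (simp add: power2_eq_square mult_ac)
  then have "2 * G * G \<le> F * G"
    by (rule mult_left_le_imp_le) (use N in simp)
  moreover have "0 \<le> G" "0 \<le> F"
    by (auto simp: G_def F_def intro!: sum_nonneg)
  ultimately have "2 * G \<le> F"
    by (cases "G = 0") (auto simp: mult_le_cancel_right)
  then show ?thesis
    using N by (simp add: avg_ip_def F_def[symmetric] G_def[unfolded g_def, symmetric] field_simps)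
qed (simp add: avg_ip_def)

lemma skew_perturbation_kernel_op:
  assumes fin: "finite V" "V \<noteq> {}"
    and skew: "\<And>v u. s v u = - s u v" and bound: "\<And>v u. \<bar>s v u\<bar> \<le> 1"
  shows "skew_perturbation (avg_ip V) (kernel_op s V) (\<lambda>_. 1)"
proof -
  interpret semi_inner_product "avg_ip V"
    by (rule semi_inner_product_avg_ip)
  show ?thesis
  proof
    show "kernel_op s V (x + y) = kernel_op s V x + kernel_op s V y" for x y
      by (auto simp: kernel_op_def algebra_simps sum.distrib add_divide_distrib)
    show "kernel_op s V (a *\<^sub>R x) = a *\<^sub>R kernel_op s V x" for a x
      by (auto simp: kernel_op_def scaleR_fun_def algebra_simps sum_distrib_left)
    show "avg_ip V (kernel_op s V x) y = - avg_ip V x (kernel_op s V y)" for x y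
    proof -
      have "(\<Sum>v\<in>V. (\<Sum>u\<in>V. s v u * x u) * y v) = (\<Sum>v\<in>V. \<Sum>u\<in>V. s v u * (x u * y v))"
        by (simp add: sum_distrib_left mult_ac)
      also have "\<dots> = (\<Sum>v\<in>V. \<Sum>u\<in>V. s u v * (x v * y u))"
        by (rule sum.swap)
      also have "\<dots> = - (\<Sum>v\<in>V. \<Sum>u\<in>V. s v u * (x v * y u))"
        unfolding sum_negf[symmetric] by (intro sum.cong refl) (subst skew, simp)
      also have "\<dots> = - (\<Sum>v\<in>V. x v * (\<Sum>u\<in>V. s v u * y u))"
        by (simp add: sum_distrib_left mult_ac)
      finally show ?thesis
        by (simp add: avg_ip_def kernel_op_def flip: sum_divide_distrib)
    qed
    show "avg_ip V (kernel_op s V x) (kernel_op s V x) \<le> avg_ip V x x / 2" for x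
      by (rule kernel_op_contraction[OF fin(1) skew bound])
    show "avg_ip V (\<lambda>_. 1) (\<lambda>_. 1) = 1"
      using fin by (simp add: avg_ip_def)
  qed
qed

section \<open>Counting walks with prescribed directions\<close>

definition oriented_arc :: "'b pair_pre_digraph \<Rightarrow> bool \<Rightarrow> 'b \<Rightarrow> 'b \<Rightarrow> bool"
  where "oriented_arc T d v u \<longleftrightarrow> (if d then (v, u) \<in> parcs T else (u, v) \<in> parcs T)"

fun is_walk :: "'b pair_pre_digraph \<Rightarrow> bool list \<Rightarrow> 'b list \<Rightarrow> bool" where
  "is_walk T [] [v] \<longleftrightarrow> v \<in> pverts T"
| "is_walk T (d # ds) (v # u # xs) \<longleftrightarrow>
     v \<in> pverts T \<and> oriented_arc T d v u \<and> is_walk T ds (u # xs)"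
| "is_walk T _ _ \<longleftrightarrow> False"

lemma is_walkI:
  assumes "length xs = Suc (length ds)" "set xs \<subseteq> pverts T"
    and "\<And>i. i < length ds \<Longrightarrow> oriented_arc T (ds ! i) (xs ! i) (xs ! Suc i)"
  shows "is_walk T ds xs"
  using assms
proof (induction T ds xs rule: is_walk.induct)
  case (2 T d ds v u xs)
  have "oriented_arc T d v u"
    using "2.prems"(3)[of 0] by simp
  moreover have "is_walk T ds (u # xs)"
    using "2.prems" by (intro "2.IH") force+
  ultimately show ?case
    using "2.prems"(2) by simp
qed auto

definition tails :: "'b pair_pre_digraph \<Rightarrow> bool list \<Rightarrow> 'b \<Rightarrow> 'b list set"
  where "tails T ds v = {xs. is_walk T ds (v # xs)}"

lemma tails_Nil: "v \<in> pverts T \<Longrightarrow> tails T [] v = {[]}"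
  by (auto simp: tails_def elim: is_walk.elims)

lemma is_walk_start:
  assumes "is_walk T ds xs"
  obtains v ys where "xs = v # ys" "v \<in> pverts T"
  using assms by (induction T ds xs rule: is_walk.induct) auto

lemma tails_Cons:
  assumes "v \<in> pverts T"
  shows "tails T (d # ds) v = (\<Union>u\<in>{u \<in> pverts T. oriented_arc T d v u}. (#) u ` tails T ds u)"
proof -
  have start: "u \<in> pverts T" if "is_walk T ds (u # xs)" for u xs
    using is_walk_start[OF that] by auto
  have "xs \<in> tails T (d # ds) v \<longleftrightarrow>
      (\<exists>u ys. xs = u # ys \<and> u \<in> pverts T \<and> oriented_arc T d v u \<and> is_walk T ds (u # ys))" for xs
    using assms start by (cases xs) (auto simp: tails_def)
  then show ?thesis
    by (auto simp: tails_def)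
qed

lemma finite_tails:
  assumes "finite (pverts T)" "v \<in> pverts T"
  shows "finite (tails T ds v)"
  using assms(2)
proof (induction ds arbitrary: v)
  case (Cons d ds)
  then show ?case
    using assms(1) by (simp add: tails_Cons)
qed (simp add: tails_Nil)

lemma card_tails_Cons:
  assumes "finite (pverts T)" "v \<in> pverts T"
  shows "card (tails T (d # ds) v) = (\<Sum>u | u \<in> pverts T \<and> oriented_arc T d v u. card (tails T ds u))"
  unfolding tails_Cons[OF assms(2)] using assms(1)
  by (subst card_UN_disjoint) (auto simp: finite_tails card_image)

context oriented_graph
begin

definition sgn_arc :: "'a \<Rightarrow> 'a \<Rightarrow> real"
  where "sgn_arc v u = of_bool ((v, u) \<in> parcs G) - of_bool ((u, v) \<in> parcs G)"

text \<open>
  Equality holds unless \<open>v\<close> and \<open>u\<close> are equal or not adjacent, so nothing is lost except on the diagonal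
  when the graph is a tournament.
\<close>

lemma oriented_arc_le: "of_bool (oriented_arc G d v u) \<le> (1 + (if d then 1 else -1) * sgn_arc v u) / 2"
  using arc_antisym[of v u] arc_antisym[of u v] by (auto simp: oriented_arc_def sgn_arc_def)

end

text \<open>
  By induction on the directions, the number of walks from \<open>v\<close> is at most \<open>(n / 2)\<^sup>k\<close> times the value at
  \<open>v\<close> of the product of the operators \<open>J \<plusminus> S\<close> applied to \<open>1\<close>; summing over \<open>v\<close> produces the inner
  product with \<open>1\<close> that was bounded above.
\<close>

theorem (in oriented_graph) card_walks_le:
  assumes ne: "pverts G \<noteq> {}"
    and long: "\<And>i j. run ds i j \<Longrightarrow> 2 \<le> j - i"
    and inner: "\<And>i j. run ds i j \<Longrightarrow> 0 < i \<Longrightarrow> j < length ds \<Longrightarrow> 4 dvd j - i"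
  shows "card {xs. is_walk G ds xs} \<le> card (pverts G) * (card (pverts G) / 2) ^ length ds"
proof -
  define V where "V = pverts G"
  have fin: "finite V" and N: "0 < real (card V)"
    using pair_finite_verts ne by (auto simp: V_def card_gt_0_iff)
  interpret skew_perturbation "avg_ip V" "kernel_op sgn_arc V" "\<lambda>_. 1"
    using fin ne by (intro skew_perturbation_kernel_op) (auto simp: V_def sgn_arc_def)
  have step_apply: "step d f v = (\<Sum>u\<in>V. (1 + (if d then 1 else -1) * sgn_arc v u) * f u) / card V"
    for d f v
    unfolding step_def U_def skew_perturbation.U_def[OF transposed]
    by (simp add: avg_ip_def kernel_op_def scaleR_fun_def sum_negf algebra_simps sum.distrib sum_subtractf add_divide_distrib diff_divide_distrib)
  have tails_le: "card (tails G ds v) \<le> (card V / 2) ^ length ds * foldr step ds (\<lambda>_. 1) v"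
    if "v \<in> V" for ds v
    using that
  proof (induction ds arbitrary: v)
    case Nil
    then show ?case by (simp add: tails_Nil V_def)
  next
    case (Cons d ds)
    define \<phi> where "\<phi> = foldr step ds (\<lambda>_. 1)"
    have IH: "real (card (tails G ds u)) \<le> (card V / 2) ^ length ds * \<phi> u" if "u \<in> V" for u
      unfolding \<phi>_def using Cons.IH[OF that] .
    have "real (card (tails G (d # ds) v))
        = (\<Sum>u | u \<in> V \<and> oriented_arc G d v u. real (card (tails G ds u)))"
      using card_tails_Cons[OF pair_finite_verts] Cons.prems by (simp add: V_def)
    also have "\<dots> = (\<Sum>u\<in>V. of_bool (oriented_arc G d v u) * real (card (tails G ds u)))"
      by (subst sum.inter_filter[OF fin]) (auto intro!: sum.cong)
    also have "\<dots> \<le> (\<Sum>u\<in>V. (1 + (if d then 1 else -1) * sgn_arc v u) / 2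
        * ((card V / 2) ^ length ds * \<phi> u))"
      using IH oriented_arc_le order_trans[OF of_nat_0_le_iff IH]
      by (intro sum_mono mult_mono order_trans[OF _ oriented_arc_le]) auto
    also have "\<dots> = (card V / 2) ^ length (d # ds) * step d \<phi> v"
    proof -
      define w where "w u = 1 + (if d then 1 else -1) * sgn_arc v u" for u
      have "(\<Sum>u\<in>V. w u / 2 * ((card V / 2) ^ length ds * \<phi> u))
          = (card V / 2) ^ length ds / 2 * (\<Sum>u\<in>V. w u * \<phi> u)"
        unfolding sum_distrib_left by (intro sum.cong) auto
      also have "\<dots> = (card V / 2) ^ length (d # ds) * ((\<Sum>u\<in>V. w u * \<phi> u) / card V)"
        using N by simp
      finally show ?thesis
        unfolding step_apply w_def .
    qed
    finally show ?case by (simp add: \<phi>_def)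
  qed
  have walks: "{xs. is_walk G ds xs} = (\<Union>v\<in>V. (#) v ` tails G ds v)"
  proof -
    have "is_walk G ds xs \<longleftrightarrow> (\<exists>v\<in>V. \<exists>ys. xs = v # ys \<and> is_walk G ds (v # ys))" for xs
      using is_walk_start[of G ds xs] unfolding V_def by blast
    then show ?thesis unfolding tails_def by blast
  qed
  have "card {xs. is_walk G ds xs} = (\<Sum>v\<in>V. card (tails G ds v))"
    unfolding walks using fin
    by (subst card_UN_disjoint) (auto simp: finite_tails pair_finite_verts V_def card_image)
  then have "real (card {xs. is_walk G ds xs}) = (\<Sum>v\<in>V. real (card (tails G ds v)))"
    by simp
  also have "\<dots> \<le> (\<Sum>v\<in>V. (card V / 2) ^ length ds * foldr step ds (\<lambda>_. 1) v)"
    by (intro sum_mono tails_le)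
  also have "\<dots> = (card V / 2) ^ length ds * (card V * avg_ip V (\<lambda>_. 1) (foldr step ds (\<lambda>_. 1)))"
    unfolding sum_distrib_left[symmetric] using N by (simp add: avg_ip_def)
  also have "\<dots> \<le> (card V / 2) ^ length ds * (card V * 1)"
    using walk_form_le_1[OF long inner] N by (intro mult_left_mono) auto
  finally show ?thesis
    by (simp add: V_def mult_ac)
qed

section \<open>Blocks of an oriented path\<close>

lemma path_order_rev:
  assumes "path_order B ws"
  shows "path_order B (rev ws)"
proof -
  have edges: "{{rev ws ! i, rev ws ! Suc i} | i. Suc i < length (rev ws)} \<subseteq> {{ws ! i, ws ! Suc i} | i. Suc i < length ws}"
    for ws :: "'a list"
  proof clarsimp
    fix i assume "Suc i < length ws"
    then have "rev ws ! i = ws ! Suc (length ws - Suc (Suc i))" "rev ws ! Suc i = ws ! (length ws - Suc (Suc i))"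
      "Suc (length ws - Suc (Suc i)) < length ws"
      by (auto simp: rev_nth Suc_diff_Suc)
    then show "\<exists>k. {rev ws ! i, rev ws ! Suc i} = {ws ! k, ws ! Suc k} \<and> Suc k < length ws"
      by (metis insert_commute)
  qed
  have "{{rev ws ! i, rev ws ! Suc i} | i. Suc i < length (rev ws)} = {{ws ! i, ws ! Suc i} | i. Suc i < length ws}"
    using edges[of ws] edges[of "rev ws"] unfolding rev_rev_ident by (rule subset_antisym)
  then show ?thesis
    using assms by (simp add: path_order_def)
qed

locale listed_path = oriented_graph P for P :: "'a pair_pre_digraph" +
  fixes vs :: "'a list"
  assumes listing: "path_order P vs"
begin

lemma vs_ne: "vs \<noteq> []" and vs_distinct: "distinct vs" and set_vs: "set vs = pverts P"
  and edges: "{{u, v} | u v. (u, v) \<in> parcs P} = {{vs ! i, vs ! Suc i} | i. Suc i < length vs}"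
  using listing by (auto simp: path_order_def)

definition forward :: "nat \<Rightarrow> bool"
  where "forward i \<longleftrightarrow> (vs ! i, vs ! Suc i) \<in> parcs P"

definition arc_at :: "nat \<Rightarrow> 'a \<times> 'a"
  where "arc_at i = (if forward i then (vs ! i, vs ! Suc i) else (vs ! Suc i, vs ! i))"

lemma arc_at_in: "Suc i < length vs \<Longrightarrow> arc_at i \<in> parcs P"
proof -
  assume "Suc i < length vs"
  then have "{vs ! i, vs ! Suc i} \<in> {{u, v} | u v. (u, v) \<in> parcs P}"
    unfolding edges by blast
  then show ?thesis
    by (auto simp: arc_at_def forward_def doubleton_eq_iff)
qed

lemma arc_cases:
  assumes "a \<in> parcs P"
  obtains i where "Suc i < length vs" "a = arc_at i"
proof -
  obtain u v where a: "a = (u, v)" by fastforce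
  have "{u, v} \<in> {{vs ! i, vs ! Suc i} | i. Suc i < length vs}"
    using assms unfolding a edges[symmetric] by blast
  then obtain i where i: "Suc i < length vs" "{u, v} = {vs ! i, vs ! Suc i}"
    by blast
  then have "a = arc_at i"
    using assms arc_antisym unfolding a arc_at_def forward_def by (auto simp: doubleton_eq_iff)
  then show ?thesis using i that by blast
qed

lemma vs_nth_eq_iff: "i < length vs \<Longrightarrow> j < length vs \<Longrightarrow> vs ! i = vs ! j \<longleftrightarrow> i = j"
  using vs_distinct by (simp add: nth_eq_iff_index_eq)

lemma arc_at_inj:
  assumes "Suc i < length vs" "Suc j < length vs" "arc_at i = arc_at j"
  shows "i = j"
  using assms by (auto simp: arc_at_def vs_nth_eq_iff split: if_splits)

definition seg :: "nat \<Rightarrow> nat \<Rightarrow> 'a pair_pre_digraph"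
  where "seg i j = \<lparr>pverts = (!) vs ` {i..j}, parcs = arc_at ` {i..<j}\<rparr>"

lemma seg_simps [simp]: "pverts (seg i j) = (!) vs ` {i..j}" "parcs (seg i j) = arc_at ` {i..<j}"
  by (simp_all add: seg_def)

lemma card_seg:
  assumes "j < length vs"
  shows "card (parcs (seg i j)) = j - i"
proof -
  have "inj_on arc_at {i..<j}"
    using assms by (auto intro!: inj_onI arc_at_inj)
  then show ?thesis by (simp add: card_image)
qed

lemma parcs_eq: "parcs P = arc_at ` {0..<length vs - 1}"
  by (auto elim!: arc_cases intro!: arc_at_in)

lemma card_parcs: "card (parcs P) = length vs - 1"
  using card_seg[of "length vs - 1" 0] vs_ne by (simp add: parcs_eq)

lemma oriented_graph_seg:
  assumes "j < length vs"
  shows "oriented_graph (seg i j)"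
proof
  fix e assume "e \<in> parcs (seg i j)"
  then obtain t where t: "e = arc_at t" "t \<in> {i..<j}" by auto
  then have "t \<in> {i..j}" "Suc t \<in> {i..j}" by auto
  then show "fst e \<in> pverts (seg i j)" "snd e \<in> pverts (seg i j)"
    unfolding t(1) arc_at_def by auto
  show "fst e \<noteq> snd e"
    using t assms by (intro pair_no_loops) (auto intro!: arc_at_in)
next
  fix u v assume "(u, v) \<in> parcs (seg i j)"
  then have "(u, v) \<in> parcs P"
    using assms by (auto simp: arc_at_in)
  then have "(v, u) \<notin> parcs P"
    by (rule arc_antisym)
  then show "(v, u) \<notin> parcs (seg i j)"
    using assms arc_at_in by fastforce
qed auto

lemma subgraph_seg:
  assumes "j < length vs"
  shows "subgraph (with_proj (seg i j)) (with_proj P)"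
proof -
  interpret B: oriented_graph "seg i j"
    using assms by (rule oriented_graph_seg)
  have "pverts (seg i j) \<subseteq> pverts P"
    using assms unfolding set_vs[symmetric] by auto
  moreover have "parcs (seg i j) \<subseteq> parcs P"
    using assms by (auto intro!: arc_at_in)
  ultimately show ?thesis
    unfolding subgraph_def compatible_def
    using B.wf_digraph_axioms wf_digraph_axioms by (simp del: seg_simps)
qed

lemma path_order_seg:
  assumes "i \<le> j" "j < length vs"
  shows "path_order (seg i j) (map ((!) vs) [i..<Suc j])"
proof -
  have "{{u, v} | u v. (u, v) \<in> parcs (seg i j)} = {{vs ! t, vs ! Suc t} | t. t \<in> {i..<j}}"
  proof (intro subset_antisym subsetI)
    fix x assume "x \<in> {{u, v} | u v. (u, v) \<in> parcs (seg i j)}"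
    then show "x \<in> {{vs ! t, vs ! Suc t} | t. t \<in> {i..<j}}"
      by (auto simp: arc_at_def split: if_splits)
  next
    fix x assume "x \<in> {{vs ! t, vs ! Suc t} | t. t \<in> {i..<j}}"
    then obtain t where t: "x = {vs ! t, vs ! Suc t}" "t \<in> {i..<j}" by blast
    have "x = {fst (arc_at t), snd (arc_at t)}"
      unfolding t(1) by (auto simp: arc_at_def)
    moreover have "(fst (arc_at t), snd (arc_at t)) \<in> parcs (seg i j)"
      using t(2) by simp
    ultimately show "x \<in> {{u, v} | u v. (u, v) \<in> parcs (seg i j)}" by blast
  qed
  also have "\<dots> = {{map ((!) vs) [i..<Suc j] ! k, map ((!) vs) [i..<Suc j] ! Suc k} | k.
      Suc k < length (map ((!) vs) [i..<Suc j])}" (is "?L = ?R")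
  proof (intro subset_antisym subsetI)
    fix x assume "x \<in> ?L"
    then obtain t where t: "x = {vs ! t, vs ! Suc t}" "t \<in> {i..<j}" by blast
    then have "x = {map ((!) vs) [i..<Suc j] ! (t - i), map ((!) vs) [i..<Suc j] ! Suc (t - i)}"
      "Suc (t - i) < length (map ((!) vs) [i..<Suc j])"
      by (auto simp del: upt_Suc)
    then show "x \<in> ?R" by blast
  next
    fix x assume "x \<in> ?R"
    then obtain k where k: "x = {map ((!) vs) [i..<Suc j] ! k, map ((!) vs) [i..<Suc j] ! Suc k}"
      "Suc k < length (map ((!) vs) [i..<Suc j])" by blast
    then have "x = {vs ! (i + k), vs ! Suc (i + k)}" "i + k \<in> {i..<j}"
      by (auto simp del: upt_Suc)
    then show "x \<in> ?L" by blast
  qed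
  finally have "{{u, v} | u v. (u, v) \<in> parcs (seg i j)} = ?R" .
  moreover have "distinct (map ((!) vs) [i..<Suc j])"
    using assms by (auto simp: distinct_map vs_nth_eq_iff intro!: inj_onI simp del: upt_Suc)
  moreover have "set (map ((!) vs) [i..<Suc j]) = pverts (seg i j)"
    by (simp add: atLeastLessThanSuc_atLeastAtMost del: upt_Suc)
  ultimately show ?thesis
    unfolding path_order_def using assms by (simp del: upt_Suc)
qed

lemma directed_subpath_seg:
  assumes "i \<le> j" "j < length vs" and const: "\<And>t. t \<in> {i..<j} \<Longrightarrow> forward t = d"
  shows "directed_subpath P (seg i j)"
proof -
  define ws where "ws = map ((!) vs) [i..<Suc j]"
  have nth: "ws ! k = vs ! (i + k)" if "k < length ws" for k
    using that unfolding ws_def by (auto simp del: upt_Suc)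
  have len: "length ws = Suc (j - i)"
    using assms(1) unfolding ws_def by (simp add: Suc_diff_le del: upt_Suc)
  have ord: "path_order (seg i j) ws"
    unfolding ws_def using assms(1,2) by (rule path_order_seg)
  have arcs: "arc_at (i + k) \<in> parcs (seg i j)" if "k < j - i" for k
    using that by auto
  have "\<exists>ws. path_order (seg i j) ws \<and>
      (\<forall>k. Suc k < length ws \<longrightarrow> (ws ! k, ws ! Suc k) \<in> parcs (seg i j))"
  proof (cases d)
    case True
    have "(ws ! k, ws ! Suc k) \<in> parcs (seg i j)" if "Suc k < length ws" for k
      using arcs[of k] const[of "i + k"] that True nth[of k] nth[of "Suc k"] len
      by (simp add: arc_at_def)
    then show ?thesis using ord by blast
  next
    case False
    have "(rev ws ! k, rev ws ! Suc k) \<in> parcs (seg i j)" if "Suc k < length (rev ws)" for k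
    proof -
      define l where "l = j - i - Suc k"
      have l: "l < j - i" "rev ws ! k = vs ! Suc (i + l)" "rev ws ! Suc k = vs ! (i + l)"
        using that len nth[of "Suc l"] nth[of l] by (auto simp: l_def rev_nth Suc_diff_Suc)
      then show ?thesis
        using arcs[of l] const[of "i + l"] False by (simp add: arc_at_def)
    qed
    then show ?thesis using path_order_rev[OF ord] by blast
  qed
  then show ?thesis
    unfolding directed_subpath_def
    using subgraph_seg[OF assms(2)] oriented_graph_seg[OF assms(2)] by blast
qed

text \<open>
  In a directed path every vertex has at most one incoming and at most one outgoing arc. At an end of a
  maximal run where the path continues, the two arcs of the path at that vertex either both enter or
  both leave it, so a directed subpath containing the run does not contain the arc beyond this end.
  Being connected, it cannot leave the segment.
\<close>

lemma block_seg:
  assumes "i < j" "j < length vs" and const: "\<And>t. t \<in> {i..<j} \<Longrightarrow> forward t = d"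
    and left: "0 < i \<Longrightarrow> forward (i - 1) \<noteq> d" and right: "Suc j < length vs \<Longrightarrow> forward j \<noteq> d"
  shows "block P (seg i j)"
  unfolding block_def
proof (intro conjI allI impI)
  show "parcs (seg i j) \<noteq> {}"
    using assms(1) by simp
  show "directed_subpath P (seg i j)"
    using assms(1-3) by (intro directed_subpath_seg) auto
  fix B assume B: "directed_subpath P B \<and> subgraph (with_proj (seg i j)) (with_proj B)"
  then have sub: "pverts (seg i j) \<subseteq> pverts B" "parcs (seg i j) \<subseteq> parcs B"
    by (auto simp: subgraph_def)
  interpret B: oriented_graph B
    using B by (simp add: directed_subpath_def)
  have BP: "parcs B \<subseteq> parcs P"
    using B by (auto simp: directed_subpath_def subgraph_def)
  obtain ws where ws: "path_order B ws"
    and fwd: "\<And>k. Suc k < length ws \<Longrightarrow> (ws ! k, ws ! Suc k) \<in> parcs B"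
    using B by (auto simp: directed_subpath_def)
  have dist: "distinct ws" and set_ws: "set ws = pverts B"
    using ws by (auto simp: path_order_def)
  have consecutive: "\<exists>k. Suc k < length ws \<and> u = ws ! k \<and> v = ws ! Suc k" if "(u, v) \<in> parcs B" for u v
  proof -
    have "{u, v} \<in> {{u, v} | u v. (u, v) \<in> parcs B}"
      using that by blast
    then obtain k where k: "Suc k < length ws" "{u, v} = {ws ! k, ws ! Suc k}"
      using ws unfolding path_order_def by auto
    then show ?thesis
      using fwd[OF k(1)] B.arc_antisym[OF that] by (auto simp: doubleton_eq_iff)
  qed
  have out_unique: "v = v'" if "(u, v) \<in> parcs B" "(u, v') \<in> parcs B" for u v v'
    using consecutive[OF that(1)] consecutive[OF that(2)] dist by (auto simp: nth_eq_iff_index_eq)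
  have in_unique: "u = u'" if "(u, v) \<in> parcs B" "(u', v) \<in> parcs B" for u u' v
    using consecutive[OF that(1)] consecutive[OF that(2)] dist by (auto simp: nth_eq_iff_index_eq)
  have turn: "False" if "Suc (Suc t) < length vs" "forward t \<noteq> forward (Suc t)"
      "arc_at t \<in> parcs B" "arc_at (Suc t) \<in> parcs B" for t
  proof -
    have "vs ! t = vs ! Suc (Suc t)"
      using that(2-4) unfolding arc_at_def
      by (cases "forward t"; cases "forward (Suc t)") (auto dest: out_unique in_unique)
    then show False
      using that(1) by (simp add: vs_nth_eq_iff)
  qed
  have inside: "a \<in> parcs (seg i j)"
    if a: "a \<in> parcs B" and touch: "fst a \<in> pverts (seg i j) \<or> snd a \<in> pverts (seg i j)" for a
  proof -
    obtain t where t: "Suc t < length vs" "a = arc_at t"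
      using a BP by (blast elim: arc_cases)
    from touch have "t \<in> {i..j} \<or> Suc t \<in> {i..j}"
      using t assms(2) unfolding t(2) by (auto simp: arc_at_def vs_nth_eq_iff split: if_splits)
    moreover have "t \<noteq> j"
    proof
      assume "t = j"
      moreover have "arc_at (j - 1) \<in> parcs B" "forward (j - 1) = d"
        using sub(2) assms(1) const[of "j - 1"] by auto
      ultimately show False
        using turn[of "j - 1"] t a right assms(1) by auto
    qed
    moreover have "Suc t \<noteq> i"
    proof
      assume "Suc t = i"
      moreover have "arc_at i \<in> parcs B" "forward i = d"
        using sub(2) assms(1) const[of i] by auto
      ultimately show False
        using turn[of t] t a left assms(1,2) by auto
    qed
    ultimately have "t \<in> {i..<j}" by auto
    then show ?thesis unfolding t(2) by simp
  qed
  have ends: "fst a \<in> pverts (seg i j) \<and> snd a \<in> pverts (seg i j)" if "a \<in> parcs (seg i j)" for a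
  proof -
    interpret S: oriented_graph "seg i j"
      using assms(2) by (rule oriented_graph_seg)
    show ?thesis
      using that S.arc_fst_in_verts S.arc_snd_in_verts by blast
  qed
  have const_membership: "ws ! k \<in> pverts (seg i j) \<longleftrightarrow> ws ! 0 \<in> pverts (seg i j)"
    if "k < length ws" for k
    using that
  proof (induction k)
    case (Suc k)
    then have "ws ! Suc k \<in> pverts (seg i j) \<longleftrightarrow> ws ! k \<in> pverts (seg i j)"
      using inside[OF fwd[of k]] ends[of "(ws ! k, ws ! Suc k)"] unfolding fst_conv snd_conv by blast
    then show ?case
      using Suc by (simp del: seg_simps)
  qed simp
  have "vs ! i \<in> set ws"
    using sub(1) assms(1) unfolding set_ws by auto
  then obtain k0 where "k0 < length ws" "ws ! k0 = vs ! i"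
    by (auto simp: in_set_conv_nth)
  moreover have "vs ! i \<in> pverts (seg i j)"
    using assms(1) by simp
  ultimately have "ws ! 0 \<in> pverts (seg i j)"
    using const_membership[of k0] by simp
  then have verts: "pverts B \<subseteq> pverts (seg i j)"
    using const_membership unfolding set_ws[symmetric] by (auto simp: in_set_conv_nth)
  have "parcs B \<subseteq> parcs (seg i j)"
    using inside verts B.arc_fst_in_verts by blast
  then show "B = seg i j"
    using verts sub by (intro pair_pre_digraph.equality) auto
qed

lemma interior_not_leaf:
  assumes "0 < t" "Suc t < length vs"
  shows "\<not> leaf P (vs ! t)"
proof -
  let ?I = "in_arcs (with_proj P) (vs ! t)" and ?O = "out_arcs (with_proj P) (vs ! t)"
  have "arc_at (t - 1) \<noteq> arc_at t"
    using arc_at_inj[of "t - 1" t] assms by auto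
  then have "2 = card {arc_at (t - 1), arc_at t}"
    by simp
  also have "\<dots> \<le> card (?I \<union> ?O)"
  proof (rule card_mono)
    show "finite (?I \<union> ?O)"
      using pair_finite_arcs by (auto simp: in_arcs_def out_arcs_def)
    show "{arc_at (t - 1), arc_at t} \<subseteq> ?I \<union> ?O"
      using assms arc_at_in[of "t - 1"] arc_at_in[of t] by (auto simp: arc_at_def split: if_splits)
  qed
  also have "\<dots> \<le> card ?I + card ?O"
    by (rule card_Un_le)
  finally show ?thesis
    by (simp add: leaf_def in_degree_def out_degree_def)
qed

definition directions :: "bool list"
  where "directions = map forward [0..<length vs - 1]"

lemma length_directions: "length directions = length vs - 1"
  by (simp add: directions_def)

lemma directions_nth: "i < length vs - 1 \<Longrightarrow> directions ! i = forward i"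
  by (simp add: directions_def)

lemma block_of_run:
  assumes "run directions i j"
  shows "block P (seg i j)" "card (parcs (seg i j)) = j - i"
    "0 < i \<Longrightarrow> j < length directions \<Longrightarrow> internal_block P (seg i j)"
proof -
  have ij: "i < j" "j \<le> length vs - 1"
    using runD(1,2)[OF assms] by (auto simp: length_directions)
  then have j: "j < length vs"
    using vs_ne by (cases vs) auto
  show "card (parcs (seg i j)) = j - i"
    using j by (rule card_seg)
  show blk: "block P (seg i j)"
  proof (rule block_seg[OF ij(1) j])
    show "forward t = directions ! i" if "t \<in> {i..<j}" for t
      using runD(6)[OF assms that] that ij directions_nth[of t] by simp
    show "forward (i - 1) \<noteq> directions ! i" if "0 < i"
      using runD(5)[OF assms that] ij directions_nth[of "i - 1"] by simp
    show "forward j \<noteq> directions ! i" if "Suc j < length vs"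
      using runD(4)[OF assms] that directions_nth[of j] by (simp add: length_directions)
  qed
  show "internal_block P (seg i j)" if "0 < i" "j < length directions"
    using blk that interior_not_leaf unfolding internal_block_def by (auto simp: length_directions)
qed

text \<open>
  Listing the images of the vertices in path order is injective on homomorphisms, because these are
  undefined outside the vertex set.
\<close>

lemma hom_count_le_walks:
  assumes "finite (pverts T)"
  shows "hom_count P T \<le> card {xs. is_walk T directions xs}"
  unfolding hom_count_def
proof (rule card_inj_on_le)
  show "inj_on (\<lambda>f. map f vs) (homs P T)"
    by (rule inj_onI) (auto simp: homs_def set_vs intro: PiE_ext)
  show "(\<lambda>f. map f vs) ` homs P T \<subseteq> {xs. is_walk T directions xs}"
  proof clarify
    fix f assume f: "f \<in> homs P T"
    show "is_walk T directions (map f vs)"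
    proof (rule is_walkI)
      show "length (map f vs) = Suc (length directions)"
        using vs_ne by (simp add: length_directions)
      show "set (map f vs) \<subseteq> pverts T"
        using f by (auto simp: homs_def set_vs)
      fix i assume "i < length directions"
      then have i: "Suc i < length vs"
        by (simp add: length_directions)
      then show "oriented_arc T (directions ! i) (map f vs ! i) (map f vs ! Suc i)"
        using f arc_at_in[OF i] by (auto simp: homs_def oriented_arc_def directions_nth arc_at_def split: if_splits)
    qed
  qed
  have "length xs = Suc (length ds) \<and> set xs \<subseteq> pverts T" if "is_walk T ds xs" for ds xs
    using that by (induction T ds xs rule: is_walk.induct) auto
  then have "{xs. is_walk T directions xs} \<subseteq> {xs. set xs \<subseteq> pverts T \<and> length xs = Suc (length directions)}"
    by blast
  then show "finite {xs. is_walk T directions xs}"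
    using finite_lists_length_eq[OF assms] finite_subset by blast
qed

end

theorem theorem1p5:
  fixes P :: "'a pair_pre_digraph"
  assumes "oriented_path P"
    and "\<And>B. block P B \<Longrightarrow> 2 \<le> card (parcs B)"
    and "\<And>B. internal_block P B \<Longrightarrow> 4 dvd card (parcs B)"
  shows "tournament_anti_sidorenko TYPE('b) P"
  unfolding tournament_anti_sidorenko_def
proof (intro allI impI)
  fix T :: "'b pair_pre_digraph"
  assume "tournament T"
  then interpret T: tournament T .
  obtain vs where "oriented_graph P" "path_order P vs"
    using assms(1) by (auto simp: oriented_path_def)
  then interpret listed_path P vs
    by (simp add: listed_path_def listed_path_axioms_def)
  define N where "N = real (card (pverts T))"
  define k where "k = length vs - 1"
  have "card (pverts P) = length vs"
    using vs_distinct distinct_card set_vs by metis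
  then have card_P: "card (pverts P) = Suc k"
    using vs_ne by (simp add: k_def)
  show "hom_density P T \<le> (1/2) ^ card (parcs P)"
  proof (cases "pverts T = {}")
    case True
    then show ?thesis
      by (simp add: hom_density_def card_P)
  next
    case False
    then have N: "0 < N"
      using T.pair_finite_verts by (simp add: N_def card_gt_0_iff)
    have "real (hom_count P T) \<le> real (card {xs. is_walk T directions xs})"
      using hom_count_le_walks[OF T.pair_finite_verts] by simp
    also have "\<dots> \<le> N * (N / 2) ^ k"
      unfolding N_def k_def length_directions[symmetric]
    proof (rule T.card_walks_le[OF False])
      show "2 \<le> j - i" if "run directions i j" for i j
        using block_of_run[OF that] assms(2) by metis
      show "4 dvd j - i" if "run directions i j" "0 < i" "j < length directions" for i j
        using block_of_run[OF that(1)] that(2,3) assms(3) by metis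
    qed
    finally have "hom_density P T \<le> N * (N / 2) ^ k / N ^ Suc k"
      unfolding hom_density_def card_P N_def[symmetric] using N by (intro divide_right_mono) auto
    also have "\<dots> = (1/2) ^ k"
      using N by (simp add: power_divide)
    finally show ?thesis
      by (simp add: card_parcs k_def)
  qed
qed

end
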